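(* Let $\mu=(\mu_0\geq\cdots\geq\mu_\ell\geq1)$ be an integer partition with $\ell\geq1$, and $1\leq d\leq\mu_0$. Let \[ \mathbf{C}_{\mu,d}(x,t)=1+\sum_{n\geq1}\sum_{w\in\mathcal{C}_\mu(d,n)}t^{\mathrm{bigtiles}(w)}x^n. \] Then \[ \mathbf{C}_{\mu,d}(x,t)=1+\frac{x\cdot\frac{\partial}{\partial x}B_{\mu,d}(x,t)}{1-B_{\mu,d}(x,t)}. \]
   Context: For $n\geq1$, $\mathcal{C}_\mu(d,n)$ is the set of cylindric anchor words of length $n$: words $a_1\cdots a_n$ over $\{1,\dotsc,d,\infty\}$ such that for every $i$ with $a_i\neq\infty$ and every $k=1,\dotsc,\ell$, $a_{i+k}\geq a_i+\mu_k$, where indices are taken cyclically modulo $n$ (in $\{1,\dotsc,n\}$) and $\infty$ is larger than every integer (these encode tilings of a cylinder of circumference $n$ and height $\mu_0+d-1$ by unit squares and translates of the Ferrers tile of $\mu$, with tile lower-left cells in column $i$, row $a_i$). $\mathrm{bigtiles}(w)$ is the number of non-$\infty$ letters. An (ordinary) anchor word of length $n$ is a word $a_1\cdots a_n$ over the same alphabet with $a_i\neq\infty\Rightarrow a_{i+k}\geq a_i+\mu_k$ for $k=1,\dotsc,\ell$ and $a_{n-\ell+1}=\cdots=a_n=\infty$; it is fault-free if it is $(\infty)$ or starts with an integer, ends with $\ell$ consecutive $\infty$'s, and that final block is the only occurrence of $\ell$ consecutive $\infty$'s. $B_{\mu,d}(x,t)=\sum x^{\mathrm{length}(w)}t^{\mathrm{bigtiles}(w)}$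 over fault-free anchor words $w$. *)

theory Defs
  imports "HOL-Computational_Algebra.Formal_Power_Series" "HOL-Library.Extended_Nat"
begin

text \<open>
  A partition \<open>(\<mu>\<^sub>0, \<dots>, \<mu>\<^sub>\<ell>)\<close> is the list of its parts, so that \<open>\<mu> ! k\<close> is \<open>\<mu>\<^sub>k\<close>.
\<close>

definition int_partition :: "nat list \<Rightarrow> bool" where
  "int_partition \<mu> \<longleftrightarrow> sorted_wrt (\<ge>) \<mu> \<and> (\<forall>m \<in> set \<mu>. 1 \<le> m)"

definition ell :: "nat list \<Rightarrow> nat" where
  "ell \<mu> = length \<mu> - 1"

text \<open>
  Words are lists over \<^typ>\<open>enat\<close>; the letter \<open>a\<^sub>i\<close> of \<open>a\<^sub>1 \<dots> a\<^sub>n\<close> is \<open>w ! (i - 1)\<close>.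
\<close>

definition letters :: "nat \<Rightarrow> enat set" where
  "letters d = insert \<infinity> (enat ` {1..d})"

definition bigtiles :: "enat list \<Rightarrow> nat" where
  "bigtiles w = length (filter (\<lambda>a. a \<noteq> \<infinity>) w)"

definition cylindric_anchor_words :: "nat list \<Rightarrow> nat \<Rightarrow> nat \<Rightarrow> enat list set" where
  "cylindric_anchor_words \<mu> d n =
     {w. length w = n \<and> set w \<subseteq> letters d \<and>
         (\<forall>i<n. w ! i \<noteq> \<infinity> \<longrightarrow>
            (\<forall>k\<in>{1..ell \<mu>}. w ! ((i + k) mod n) \<ge> w ! i + enat (\<mu> ! k)))}"

text \<open>
  The guard \<open>i + k < length w\<close> only keeps indices in range: a finite letter never occurs among
  the last \<open>\<ell>\<close> ones.  In a word shorter than \<open>\<ell>\<close> all letters are required to be \<open>\<infinity>\<close>.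
\<close>

definition anchor_word :: "nat list \<Rightarrow> nat \<Rightarrow> enat list \<Rightarrow> bool" where
  "anchor_word \<mu> d w \<longleftrightarrow>
     set w \<subseteq> letters d \<and>
     (\<forall>i<length w. w ! i \<noteq> \<infinity> \<longrightarrow>
        (\<forall>k\<in>{1..ell \<mu>}. i + k < length w \<longrightarrow> w ! (i + k) \<ge> w ! i + enat (\<mu> ! k))) \<and>
     (\<forall>i<length w. length w \<le> i + ell \<mu> \<longrightarrow> w ! i = \<infinity>)"

definition infinity_block_at :: "nat \<Rightarrow> enat list \<Rightarrow> nat \<Rightarrow> bool" where
  "infinity_block_at l w j \<longleftrightarrow> j + l \<le> length w \<and> (\<forall>i\<in>{j..<j + l}. w ! i = \<infinity>)"

definition fault_free :: "nat list \<Rightarrow> nat \<Rightarrow> enat list \<Rightarrow> bool" where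
  "fault_free \<mu> d w \<longleftrightarrow>
     anchor_word \<mu> d w \<and>
     (w = [\<infinity>] \<or>
      (w \<noteq> [] \<and> hd w \<noteq> \<infinity> \<and>
       infinity_block_at (ell \<mu>) w (length w - ell \<mu>) \<and>
       (\<forall>j. infinity_block_at (ell \<mu>) w j \<longrightarrow> j = length w - ell \<mu>)))"

text \<open>
  Series in \<open>x\<close> and \<open>t\<close> are elements of \<open>\<rat>[[t]][[x]]\<close>: the outer \<^const>\<open>fps_X\<close> is \<open>x\<close>, the inner
  one is \<open>t\<close>, and \<^const>\<open>fps_deriv\<close> on the outer level is \<open>\<partial>/\<partial>x\<close>.  Rational rather than integer
  coefficients are used only because division of series needs an inverse on coefficients.
\<close>

definition B_series :: "nat list \<Rightarrow> nat \<Rightarrow> rat fps fps" where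
  "B_series \<mu> d = Abs_fps (\<lambda>n. \<Sum>w\<in>{w. fault_free \<mu> d w \<and> length w = n}. fps_X ^ bigtiles w)"

definition C_series :: "nat list \<Rightarrow> nat \<Rightarrow> rat fps fps" where
  "C_series \<mu> d = 1 + Abs_fps (\<lambda>n. if n \<ge> 1
     then \<Sum>w\<in>cylindric_anchor_words \<mu> d n. fps_X ^ bigtiles w else 0)"

lemma finite_letters_words: "finite {w. set w \<subseteq> letters d \<and> length w = n}"
  by (rule finite_lists_length_eq) (simp add: letters_def)

lemma finite_cylindric_anchor_words: "finite (cylindric_anchor_words \<mu> d n)"
  by (rule finite_subset[OF _ finite_letters_words[of d n]])
    (auto simp: cylindric_anchor_words_def)

lemma finite_fault_free: "finite {w. fault_free \<mu> d w \<and> length w = n}"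
  by (rule finite_subset[OF _ finite_letters_words[of d n]])
    (auto simp: fault_free_def anchor_word_def)

text \<open>\<open>1 - B\<close> is a unit of \<open>\<rat>[[t]][[x]]\<close>, so the library's total division is a genuine quotient here.\<close>

lemma B_series_nth_0: "fps_nth (B_series \<mu> d) 0 = 0"
proof -
  have *: "{w. fault_free \<mu> d w \<and> length w = 0} = {}"
    by (auto simp: fault_free_def)
  show ?thesis
    unfolding B_series_def fps_nth_Abs_fps * by (rule sum.empty)
qed

lemma divide_one_minus_B_series_iff:
  "f / (1 - B_series \<mu> d) = g \<longleftrightarrow> f = g * (1 - B_series \<mu> d)"
proof -
  let ?u = "1 - B_series \<mu> d"
  have u0: "fps_nth ?u 0 = 1"
    by (simp add: B_series_nth_0)
  have "subdegree ?u = 0"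
    using u0 by (intro subdegree_eq_0) simp
  then have div: "f / ?u = f * inverse ?u"
    by (simp add: fps_divide_def)
  have inv1: "inverse (1 :: rat fps) = 1"
    by (rule fps_inverse_one'[OF inverse_1])
  have "inverse ?u = fps_right_inverse ?u 1"
    by (simp only: fps_inverse_def[of ?u] u0 inv1)
  moreover have "?u * fps_right_inverse ?u 1 = 1"
    by (rule fps_right_inverse) (simp only: u0 mult_1)
  ultimately have unit: "?u * inverse ?u = 1"
    by (simp only:)
  have "g * ?u * inverse ?u = g" for g
    by (simp only: mult.assoc unit mult_1_right)
  moreover have "f * inverse ?u * ?u = f"
    by (simp only: mult.assoc mult.commute[of "inverse ?u"] unit mult_1_right)
  ultimately show ?thesis
    unfolding div by (auto simp only:)
qed

end

theory Submission
  imports Defs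
begin

text \<open>
  Call a position of a cylindric word a cut if the \<open>\<ell>\<close> letters cyclically before it are all \<open>\<infinity>\<close>;
  equivalently, reading the word from there gives an ordinary anchor word.  The letters following
  a largest finite letter are \<open>\<infinity>\<close>, so there is always a cut.  Consecutive cuts bound
  fault-free words, so a cylindric word is, up to a rotation, a fault-free word containing the
  origin followed by an anchor word.  This gives \<open>\<^bold>C - 1 = (x \<partial>B/\<partial>x) A\<close>, where \<open>A\<close>
  counts anchor words, and splitting off the first fault-free factor gives \<open>A = 1 + B A\<close>.
\<close>

section \<open>Generating functions of weighted sets\<close>

text \<open>Elements of \<open>S\<close> are marked by x to the power \<open>len\<close> (outer
  series) and t to the power \<open>wt\<close> (inner series). An infinite fibre would sum to 0,
  hence the finiteness assumptions in the product rule.\<close>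

definition gf :: "'a set \<Rightarrow> ('a \<Rightarrow> nat) \<Rightarrow> ('a \<Rightarrow> nat) \<Rightarrow> rat fps fps" where
  "gf S len wt = Abs_fps (\<lambda>n. \<Sum>s\<in>{s \<in> S. len s = n}. fps_X ^ wt s)"

lemma gf_nth: "fps_nth (gf S len wt) n = (\<Sum>s\<in>{s \<in> S. len s = n}. fps_X ^ wt s)"
  by (simp add: gf_def)

lemma gf_bij_betw:
  assumes "bij_betw f S T"
    and "\<And>s. s \<in> S \<Longrightarrow> len' (f s) = len s"
    and "\<And>s. s \<in> S \<Longrightarrow> wt' (f s) = wt s"
  shows "gf T len' wt' = gf S len wt"
proof (rule fps_ext)
  fix n
  have "bij_betw f {s \<in> S. len s = n} {t \<in> T. len' t = n}"
    using assms(1,2) unfolding bij_betw_def by (auto intro: inj_on_subset)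
  from sum.reindex_bij_betw[OF this, of "\<lambda>t. (fps_X :: rat fps) ^ wt' t"]
  show "fps_nth (gf T len' wt') n = fps_nth (gf S len wt) n"
    using assms(3) by (simp add: gf_nth)
qed

text \<open>The Cauchy product: pairs of total length \<open>n\<close> are sorted by the length
  \<open>i\<close> of their first component.\<close>

lemma gf_Times:
  assumes "\<And>n. finite {s \<in> S. len s = n}" "\<And>n. finite {t \<in> T. len' t = n}"
  shows "gf (S \<times> T) (\<lambda>(s, t). len s + len' t) (\<lambda>(s, t). wt s + wt' t)
    = gf S len wt * gf T len' wt'"
proof (rule fps_ext)
  fix n
  let ?S = "\<lambda>i. {s \<in> S. len s = i}" and ?T = "\<lambda>i. {t \<in> T. len' t = i}"
  have fib: "{p \<in> S \<times> T. (\<lambda>(s, t). len s + len' t) p = n} = (\<Union>i\<in>{0..n}. ?S i \<times> ?T (n - i))"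
    by auto
  let ?w = "\<lambda>p. (fps_X :: rat fps) ^ (case p of (s, t) \<Rightarrow> wt s + wt' t)"
  have "fps_nth (gf (S \<times> T) (\<lambda>(s, t). len s + len' t) (\<lambda>(s, t). wt s + wt' t)) n
      = sum ?w (\<Union>i\<in>{0..n}. ?S i \<times> ?T (n - i))"
    unfolding gf_nth fib ..
  also have "\<dots> = (\<Sum>i=0..n. sum ?w (?S i \<times> ?T (n - i)))"
    using assms by (intro sum.UNION_disjoint) auto
  also have "\<dots> = (\<Sum>i=0..n. (\<Sum>s\<in>?S i. fps_X ^ wt s) * (\<Sum>t\<in>?T (n - i). fps_X ^ wt' t))"
    by (simp only: sum_product sum.cartesian_product power_add case_prod_unfold)
  also have "\<dots> = fps_nth (gf S len wt * gf T len' wt') n"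
    by (simp only: fps_mult_nth gf_nth)
  finally show "fps_nth (gf (S \<times> T) (\<lambda>(s, t). len s + len' t) (\<lambda>(s, t). wt s + wt' t)) n
      = fps_nth (gf S len wt * gf T len' wt') n" .
qed

text \<open>Combinatorial counterpart of the operator x d/dx: a word together with one marked
  position.\<close>

definition pointed :: "'a list set \<Rightarrow> (nat \<times> 'a list) set" where
  "pointed S = {(p, w). w \<in> S \<and> p < length w}"

lemma pointed_fibre:
  "{q \<in> pointed S. (length \<circ> snd) q = n} = {..<n} \<times> {w \<in> S. length w = n}"
  by (auto simp: pointed_def)

lemma gf_pointed:
  "gf (pointed S) (length \<circ> snd) (wt \<circ> snd) = fps_X * fps_deriv (gf S length wt)"
proof (rule fps_ext)
  fix n
  have "fps_nth (gf (pointed S) (length \<circ> snd) (wt \<circ> snd)) n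
      = of_nat n * fps_nth (gf S length wt) n"
    unfolding gf_nth pointed_fibre
    by (simp add: sum.cartesian_product')
  then show "fps_nth (gf (pointed S) (length \<circ> snd) (wt \<circ> snd)) n
      = fps_nth (fps_X * fps_deriv (gf S length wt)) n"
    \<comment> \<open>Multiplying by x undoes the index shift of the derivative; both sides vanish
      at \<open>n = 0\<close>.\<close>
    by (cases n) simp_all
qed

section \<open>Anchor words and their fault-free factors\<close>

lemma bigtiles_append: "bigtiles (u @ v) = bigtiles u + bigtiles v"
  by (simp add: bigtiles_def)

lemma bigtiles_rotate: "bigtiles (rotate p w) = bigtiles w"
  unfolding rotate_drop_take bigtiles_append
  by (subst add.commute) (simp only: bigtiles_append[symmetric] append_take_drop_id)

text \<open>By the contrapositive of the last clause of the definition, a finite letter has its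
  \<open>ell \<mu>\<close> successors inside the word, so the range guard turns from a premise into
  a conclusion.\<close>

lemma anchor_word_iff:
  "anchor_word \<mu> d w \<longleftrightarrow> set w \<subseteq> letters d \<and>
     (\<forall>i<length w. w ! i \<noteq> \<infinity> \<longrightarrow> i + ell \<mu> < length w \<and>
        (\<forall>k\<in>{1..ell \<mu>}. w ! i + enat (\<mu> ! k) \<le> w ! (i + k)))"
proof
  assume w: "anchor_word \<mu> d w"
  then have "i + ell \<mu> < length w" if "i < length w" "w ! i \<noteq> \<infinity>" for i
    using that unfolding anchor_word_def by (meson not_le)
  then show "set w \<subseteq> letters d \<and> (\<forall>i<length w. w ! i \<noteq> \<infinity> \<longrightarrow> i + ell \<mu> < length w \<and>
      (\<forall>k\<in>{1..ell \<mu>}. w ! i + enat (\<mu> ! k) \<le> w ! (i + k)))"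
    using w unfolding anchor_word_def
    by (metis atLeastAtMost_iff add_left_mono order_le_less_trans)
next
  assume "set w \<subseteq> letters d \<and> (\<forall>i<length w. w ! i \<noteq> \<infinity> \<longrightarrow> i + ell \<mu> < length w \<and>
      (\<forall>k\<in>{1..ell \<mu>}. w ! i + enat (\<mu> ! k) \<le> w ! (i + k)))"
  then show "anchor_word \<mu> d w"
    unfolding anchor_word_def by (meson not_le)
qed

lemma anchor_wordD:
  assumes "anchor_word \<mu> d w" "i < length w" "w ! i \<noteq> \<infinity>"
  shows "i + ell \<mu> < length w" "k \<in> {1..ell \<mu>} \<Longrightarrow> w ! i + enat (\<mu> ! k) \<le> w ! (i + k)"
  using assms unfolding anchor_word_iff by blast+

lemma anchor_word_Nil: "anchor_word \<mu> d []"
  by (simp add: anchor_word_def)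

text \<open>No condition crosses the seam: the \<open>ell \<mu>\<close> successors of a finite
  letter of \<open>u\<close> already lie in \<open>u\<close>.\<close>

lemma anchor_word_append:
  assumes "anchor_word \<mu> d u" "anchor_word \<mu> d v"
  shows "anchor_word \<mu> d (u @ v)"
  unfolding anchor_word_iff
proof (intro conjI allI impI)
  show "set (u @ v) \<subseteq> letters d"
    using assms by (simp add: anchor_word_def)
  fix i assume i: "i < length (u @ v)" "(u @ v) ! i \<noteq> \<infinity>"
  have "i + ell \<mu> < length (u @ v) \<and>
      (\<forall>k\<in>{1..ell \<mu>}. (u @ v) ! i + enat (\<mu> ! k) \<le> (u @ v) ! (i + k))"
  proof (cases "i < length u")
    case True
    then show ?thesis
      using i assms(1) by (auto simp: anchor_word_iff nth_append)
  next
    case False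
    define j where "j = i - length u"
    have "j < length v" "v ! j \<noteq> \<infinity>" "i = length u + j"
      using False i by (auto simp: j_def nth_append)
    then show ?thesis
      using assms(2) by (auto simp: anchor_word_iff nth_append add.assoc)
  qed
  then show "i + ell \<mu> < length (u @ v)"
    "\<forall>k\<in>{1..ell \<mu>}. (u @ v) ! i + enat (\<mu> ! k) \<le> (u @ v) ! (i + k)"
    by blast+
qed

lemma anchor_word_appendD2:
  assumes "anchor_word \<mu> d (u @ v)"
  shows "anchor_word \<mu> d v"
  unfolding anchor_word_iff
proof (intro conjI allI impI)
  show "set v \<subseteq> letters d"
    using assms by (simp add: anchor_word_def)
  fix i assume i: "i < length v" "v ! i \<noteq> \<infinity>"
  have *: "length u + i < length (u @ v)" "(u @ v) ! (length u + i) \<noteq> \<infinity>"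
    using i by auto
  show "i + ell \<mu> < length v" "\<forall>k\<in>{1..ell \<mu>}. v ! i + enat (\<mu> ! k) \<le> v ! (i + k)"
    using anchor_wordD[OF assms *] by (auto simp: add.assoc)
qed

text \<open>A prefix might separate a finite letter from its successors; the second assumption
  excludes this.\<close>

lemma anchor_word_appendD1:
  assumes "anchor_word \<mu> d (u @ v)"
    and "\<And>i. i < length u \<Longrightarrow> length u \<le> i + ell \<mu> \<Longrightarrow> u ! i = \<infinity>"
  shows "anchor_word \<mu> d u"
  unfolding anchor_word_def
proof (intro conjI allI impI ballI)
  show "set u \<subseteq> letters d"
    using assms(1) by (simp add: anchor_word_def)
  fix i k assume "i < length u" "u ! i \<noteq> \<infinity>" "k \<in> {1..ell \<mu>}" "i + k < length u"
  then show "u ! i + enat (\<mu> ! k) \<le> u ! (i + k)"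
    using anchor_wordD(2)[OF assms(1), of i k] by (simp add: nth_append)
qed (use assms(2) in auto)

section \<open>Unique first fault-free factor\<close>

lemma infinity_block_at_append:
  "infinity_block_at l u j \<Longrightarrow> infinity_block_at l (u @ v) j"
  by (auto simp: infinity_block_at_def nth_append)

lemma infinity_block_at_appendD:
  "infinity_block_at l (u @ v) j \<Longrightarrow> j + l \<le> length u \<Longrightarrow> infinity_block_at l u j"
  by (auto simp: infinity_block_at_def nth_append)

lemma fault_free_infinity: "fault_free \<mu> d [\<infinity>]"
  by (simp add: fault_free_def anchor_word_def letters_def)

text \<open>A leading \<infinity> is a factor by itself. Otherwise the word is cut right after its
  leftmost block of \<open>ell \<mu>\<close> infinities, which exists because the word ends with
  such a block.\<close>

lemma fault_free_factor_exists:
  assumes "anchor_word \<mu> d w" "w \<noteq> []" "1 \<le> ell \<mu>"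
  obtains w0 u where "w = w0 @ u" "fault_free \<mu> d w0" "anchor_word \<mu> d u"
proof (cases "hd w = \<infinity>")
  case True
  then have "w = [\<infinity>] @ tl w"
    using assms(2) by (cases w) auto
  then show thesis
    using that fault_free_infinity assms(1) anchor_word_appendD2 by metis
next
  case False
  let ?l = "ell \<mu>" and ?P = "infinity_block_at (ell \<mu>) w"
  have len: "?l < length w"
    using assms False unfolding anchor_word_iff by (auto simp: hd_conv_nth)
  have "?P (length w - ?l)"
    using assms(1) len by (auto simp: infinity_block_at_def anchor_word_def)
  then obtain j where j: "?P j" "\<And>i. ?P i \<Longrightarrow> j \<le> i"
    using LeastI[of ?P] Least_le[of ?P] by blast
  define w0 u where "w0 = take (j + ?l) w" and "u = drop (j + ?l) w"
  have w: "w = w0 @ u"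
    by (simp add: w0_def u_def)
  have jl: "j + ?l \<le> length w"
    using j(1) by (simp add: infinity_block_at_def)
  then have len0: "length w0 = j + ?l"
    by (simp add: w0_def)
  have blk: "infinity_block_at ?l w0 j"
    using j(1) infinity_block_at_appendD[of ?l w0 u j] len0 w by simp
  have "anchor_word \<mu> d w0"
    using assms(1)[unfolded w] by (rule anchor_word_appendD1)
      (use blk len0 in \<open>auto simp: infinity_block_at_def\<close>)
  \<comment> \<open>The length of \<open>w0\<close> bounds \<open>i\<close> from above. A block of
    \<open>w0\<close> is also one of \<open>w\<close>, so the choice of \<open>j\<close> bounds it
    from below.\<close>
  moreover have "i = j" if i: "infinity_block_at ?l w0 i" for i
  proof (rule antisym)
    show "i \<le> j" using i len0 by (simp add: infinity_block_at_def)
    show "j \<le> i" using j(2) infinity_block_at_append[OF i, of u] w by simp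
  qed
  moreover have "w0 \<noteq> []" "hd w0 = hd w"
    using assms(2,3) by (simp_all add: w0_def)
  ultimately have "fault_free \<mu> d w0"
    using blk len0 False unfolding fault_free_def by (metis add_diff_cancel_right')
  then show thesis
    using that[OF w] assms(1)[unfolded w] anchor_word_appendD2 by blast
qed

text \<open>Fault-free words form a prefix code: the block closing the shorter word also occurs in
  the longer one, where the only block is the final one, so the lengths agree.\<close>

lemma fault_free_factor_unique:
  assumes "fault_free \<mu> d u" "fault_free \<mu> d v" "u @ r = v @ s"
  shows "u = v"
proof -
  have *: "u = v"
    if "fault_free \<mu> d u" "fault_free \<mu> d v" "u @ r = v @ s" "length u \<le> length v" for u v r s
  proof -
    have take: "u = take (length u) v"
      using that(3,4) by (metis append_eq_append_conv_if append_take_drop_id)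
    have v: "v = u @ drop (length u) v"
      using take by (metis append_take_drop_id)
    have "u \<noteq> []" "v \<noteq> []"
      using that(1,2) by (auto simp: fault_free_def)
    then have hd: "hd v = hd u"
      by (subst v) simp
    show "u = v"
    proof (cases "hd u = \<infinity>")
      case True
      then have "u = [\<infinity>]" "v = [\<infinity>]"
        using that(1,2) hd unfolding fault_free_def by metis+
      then show ?thesis by simp
    next
      case False
      then have blk: "infinity_block_at (ell \<mu>) u (length u - ell \<mu>)"
        using that(1) unfolding fault_free_def by force
      have "infinity_block_at (ell \<mu>) v (length u - ell \<mu>)"
        by (subst v) (rule infinity_block_at_append[OF blk])
      moreover have "v \<noteq> [\<infinity>]"
        using False hd by auto
      ultimately have "length u - ell \<mu> = length v - ell \<mu>"
        using that(2) unfolding fault_free_def by blast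
      \<comment> \<open>The subtractions are not truncated: \<open>blk\<close> gives
        \<open>ell \<mu> \<le> length u\<close>, and \<open>length u \<le> length v\<close>.\<close>
      then have "length u = length v"
        using that(4) blk unfolding infinity_block_at_def by linarith
      then show ?thesis using take by simp
    qed
  qed
  show ?thesis
    using *[OF assms] *[OF assms(2,1) assms(3)[symmetric]] nat_le_linear by blast
qed

text \<open>Source of the equation A = 1 + B A; the empty word is the one anchor word without a
  first factor.\<close>

lemma bij_betw_first_factor:
  assumes "1 \<le> ell \<mu>"
  shows "bij_betw (\<lambda>(w, u). w @ u) (Collect (fault_free \<mu> d) \<times> Collect (anchor_word \<mu> d))
    (Collect (anchor_word \<mu> d) - {[]})"
  unfolding bij_betw_def
proof (intro conjI equalityI subsetI)
  show "inj_on (\<lambda>(w, u). w @ u) (Collect (fault_free \<mu> d) \<times> Collect (anchor_word \<mu> d))"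
    by (rule inj_onI) (clarsimp, metis append_same_eq fault_free_factor_unique same_append_eq)
next
  fix w assume "w \<in> (\<lambda>(w, u). w @ u) ` (Collect (fault_free \<mu> d) \<times> Collect (anchor_word \<mu> d))"
  then show "w \<in> Collect (anchor_word \<mu> d) - {[]}"
    by (auto simp: fault_free_def intro: anchor_word_append)
next
  fix w assume "w \<in> Collect (anchor_word \<mu> d) - {[]}"
  then obtain w0 u where "w = w0 @ u" "fault_free \<mu> d w0" "anchor_word \<mu> d u"
    using fault_free_factor_exists assms by blast
  then show "w \<in> (\<lambda>(w, u). w @ u) ` (Collect (fault_free \<mu> d) \<times> Collect (anchor_word \<mu> d))"
    by (intro image_eqI[of _ _ "(w0, u)"]) simp_all
qed

section \<open>Cutting a cylindric word\<close>

text \<open>All circumferences at once. The empty word is left out since the constant term 1 of the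
  series is added separately.\<close>

definition cylindric :: "nat list \<Rightarrow> nat \<Rightarrow> enat list set" where
  "cylindric \<mu> d = {w. w \<noteq> [] \<and> w \<in> cylindric_anchor_words \<mu> d (length w)}"

section \<open>Passing between cylindric and ordinary words\<close>

lemma cylindric_iff:
  "w \<in> cylindric \<mu> d \<longleftrightarrow> w \<noteq> [] \<and> set w \<subseteq> letters d \<and>
     (\<forall>i<length w. w ! i \<noteq> \<infinity> \<longrightarrow>
        (\<forall>k\<in>{1..ell \<mu>}. w ! i + enat (\<mu> ! k) \<le> w ! ((i + k) mod length w)))"
  by (auto simp: cylindric_def cylindric_anchor_words_def)

text \<open>The successors of a finite letter stay inside the word, so reducing indices modulo the
  length changes nothing.\<close>

lemma cylindric_if_anchor_word:
  assumes "anchor_word \<mu> d w" "w \<noteq> []"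
  shows "w \<in> cylindric \<mu> d"
  unfolding cylindric_iff
proof (intro conjI allI impI ballI)
  fix i k assume *: "i < length w" "w ! i \<noteq> \<infinity>" "k \<in> {1..ell \<mu>}"
  have "i + k < length w"
    using anchor_wordD(1)[OF assms(1) *(1,2)] *(3) by simp
  then show "w ! i + enat (\<mu> ! k) \<le> w ! ((i + k) mod length w)"
    using anchor_wordD(2)[OF assms(1) *] by simp
qed (use assms in \<open>auto simp: anchor_word_def\<close>)

lemma anchor_word_if_cylindric:
  assumes "w \<in> cylindric \<mu> d"
    and "\<And>i. i < length w \<Longrightarrow> length w \<le> i + ell \<mu> \<Longrightarrow> w ! i = \<infinity>"
  shows "anchor_word \<mu> d w"
  unfolding anchor_word_def
proof (intro conjI allI impI ballI)
  show "set w \<subseteq> letters d"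
    using assms(1) by (simp add: cylindric_iff)
  fix i k assume "i < length w" "w ! i \<noteq> \<infinity>" "k \<in> {1..ell \<mu>}" "i + k < length w"
  then show "w ! i + enat (\<mu> ! k) \<le> w ! (i + k)"
    using assms(1) unfolding cylindric_iff by (metis mod_less)
qed (use assms(2) in auto)

lemma cylindric_rotate:
  assumes "w \<in> cylindric \<mu> d"
  shows "rotate p w \<in> cylindric \<mu> d"
proof -
  let ?n = "length w"
  have n: "0 < ?n" using assms by (simp add: cylindric_iff)
  have "rotate p w ! i + enat (\<mu> ! k) \<le> rotate p w ! ((i + k) mod ?n)"
    if "i < ?n" "rotate p w ! i \<noteq> \<infinity>" "k \<in> {1..ell \<mu>}" for i k
  proof -
    have "rotate p w ! ((i + k) mod ?n) = w ! (((p + i) mod ?n + k) mod ?n)"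
      using n by (simp add: nth_rotate mod_simps add.assoc)
    then show ?thesis
      using assms that n by (simp add: nth_rotate cylindric_iff)
  qed
  then show ?thesis
    using assms by (simp add: cylindric_iff)
qed

section \<open>Existence and position of cuts\<close>

lemma int_partition_nth_pos:
  assumes "int_partition \<mu>" "k \<in> {1..ell \<mu>}"
  shows "1 \<le> \<mu> ! k"
  using assms by (auto simp: int_partition_def ell_def)

text \<open>All parts are positive, so a finite successor of a largest finite letter would exceed
  it. Its \<open>ell \<mu>\<close> successors are therefore \<infinity>, and the word can be cut
  after them.\<close>

lemma cylindric_has_cut:
  assumes "int_partition \<mu>" "w \<in> cylindric \<mu> d"
  shows "\<exists>p. anchor_word \<mu> d (rotate p w)"
proof (cases "\<forall>i<length w. w ! i = \<infinity>")
  case True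
  then have "anchor_word \<mu> d w"
    using assms(2) by (simp add: cylindric_iff anchor_word_def)
  then have "anchor_word \<mu> d (rotate 0 w)" by simp
  then show ?thesis ..
next
  case False
  let ?n = "length w"
  have n: "0 < ?n" using assms(2) by (simp add: cylindric_iff)
  let ?F = "{i. i < ?n \<and> w ! i \<noteq> \<infinity>}"
  have F: "finite ?F" "?F \<noteq> {}" using False by auto
  have "Max ((!) w ` ?F) \<in> (!) w ` ?F"
    using F by simp
  then obtain j where "j \<in> ?F" "w ! j = Max ((!) w ` ?F)"
    by auto
  then have j: "j < ?n" "w ! j \<noteq> \<infinity>" "\<And>i. i < ?n \<Longrightarrow> w ! i \<noteq> \<infinity> \<Longrightarrow> w ! i \<le> w ! j"
    using F(1) by auto
  have inf: "w ! ((j + k) mod ?n) = \<infinity>" if k: "k \<in> {1..ell \<mu>}" for k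
  proof (rule ccontr)
    assume *: "w ! ((j + k) mod ?n) \<noteq> \<infinity>"
    have "w ! j + enat (\<mu> ! k) \<le> w ! ((j + k) mod ?n)"
      using assms(2) j k by (auto simp: cylindric_iff)
    also have "\<dots> \<le> w ! j"
      using j(3) * n by simp
    finally show False
      using j(2) int_partition_nth_pos[OF assms(1) k] by (cases "w ! j") auto
  qed
  \<comment> \<open>Otherwise \<open>k = ?n\<close> is admissible and leads around the cylinder back
    to \<open>j\<close>, whose letter is finite.\<close>
  have short: "ell \<mu> < ?n"
  proof (rule ccontr)
    assume "\<not> ?thesis"
    then show False using inf[of ?n] n j(1,2) by auto
  qed
  \<comment> \<open>The infinities occupy \<open>j + 1\<close> to \<open>j + ell \<mu>\<close>
    cyclically, so reading starts one place further and they come last.\<close>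
  have "anchor_word \<mu> d (rotate (j + ell \<mu> + 1) w)"
  proof (rule anchor_word_if_cylindric[OF cylindric_rotate[OF assms(2)]])
    fix i assume i: "i < length (rotate (j + ell \<mu> + 1) w)"
      "length (rotate (j + ell \<mu> + 1) w) \<le> i + ell \<mu>"
    \<comment> \<open>Position \<open>i\<close> of the rotated word is the \<open>k\<close>-th place
      after \<open>j\<close> on the cylinder.\<close>
    define k where "k = i + ell \<mu> + 1 - ?n"
    have "k \<in> {1..ell \<mu>}" and eq: "j + ell \<mu> + 1 + i = j + k + ?n"
      using i short by (auto simp: k_def)
    moreover have "rotate (j + ell \<mu> + 1) w ! i = w ! ((j + ell \<mu> + 1 + i) mod ?n)"
      using i(1) by (intro nth_rotate) simp
    ultimately show "rotate (j + ell \<mu> + 1) w ! i = \<infinity>"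
      unfolding eq using inf by simp
  qed
  then show ?thesis ..
qed

text \<open>A cut at a positive \<open>q\<close> makes \<open>take q w\<close> an anchor word
  starting with an integer. It ends with a block of infinities that lies strictly before the end of
  \<open>w\<close>, where fault-freeness allows none.\<close>

lemma no_cut_inside_fault_free:
  assumes "fault_free \<mu> d w" "q < length w" "anchor_word \<mu> d (rotate q (w @ u))"
  shows "q = 0"
proof (rule ccontr)
  assume q: "q \<noteq> 0"
  let ?l = "ell \<mu>"
  have "w \<noteq> [\<infinity>]" using assms(2) q by auto
  then have ff: "hd w \<noteq> \<infinity>" "\<And>j. infinity_block_at ?l w j \<Longrightarrow> j = length w - ?l"
    using assms(1) by (auto simp: fault_free_def)
  have "rotate q (w @ u) = (drop q w @ u) @ take q w"
    using assms(2) by (simp add: rotate_drop_take)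
  with assms(3) have pre: "anchor_word \<mu> d (take q w)"
    using anchor_word_appendD2 by metis
  have "?l < q"
    using anchor_wordD(1)[OF pre, of 0] ff(1) q assms(2) hd_conv_nth[of w] by force
  moreover have "infinity_block_at ?l w (q - ?l)"
    using pre assms(2) \<open>?l < q\<close> by (auto simp: infinity_block_at_def anchor_word_def)
  ultimately show False
    using ff(2)[of "q - ?l"] assms(2) by linarith
qed

text \<open>
  The pair \<open>(p, w)\<close> records that the origin lies \<open>p\<close> places after the start of its
  fault-free factor \<open>w\<close>.
\<close>

lemma bij_betw_cylindric:
  assumes "int_partition \<mu>" "1 \<le> ell \<mu>"
  shows "bij_betw (\<lambda>((p, w), u). rotate p (w @ u))
    (pointed (Collect (fault_free \<mu> d)) \<times> Collect (anchor_word \<mu> d)) (cylindric \<mu> d)"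
  unfolding bij_betw_def
proof (intro conjI equalityI subsetI)
  \<comment> \<open>By symmetry \<open>p \<le> p'\<close>. Cancelling \<open>rotate p\<close>
    exhibits a cut of \<open>w' @ u'\<close> at \<open>p' - p\<close>, inside \<open>w'\<close>, so
    the offsets agree and uniqueness of the first factor finishes.\<close>
  have *: "p = p' \<and> w = w' \<and> u = u'"
    if "fault_free \<mu> d w" "p < length w" "anchor_word \<mu> d u"
      "fault_free \<mu> d w'" "p' < length w'" "anchor_word \<mu> d u'"
      "rotate p (w @ u) = rotate p' (w' @ u')" "p \<le> p'" for p w u p' w' u'
  proof -
    have "rotate p (w @ u) = rotate p (rotate (p' - p) (w' @ u'))"
      using that(7,8) by (simp add: rotate_rotate)
    moreover have "inj (rotate p :: enat list \<Rightarrow> _)"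
      unfolding rotate_def by (intro inj_fn inj_rotate1)
    ultimately have eq: "w @ u = rotate (p' - p) (w' @ u')"
      by (simp add: inj_eq)
    have "anchor_word \<mu> d (w @ u)"
      using that(1,3) by (auto simp: fault_free_def intro: anchor_word_append)
    then have "p' - p = 0"
      using that(4,5) eq by (intro no_cut_inside_fault_free[of \<mu> d w' _ u']) auto
    then show ?thesis
      using that(1,4,8) eq fault_free_factor_unique[of \<mu> d w w' u u'] by auto
  qed
  show "inj_on (\<lambda>((p, w), u). rotate p (w @ u))
      (pointed (Collect (fault_free \<mu> d)) \<times> Collect (anchor_word \<mu> d))"
  proof (rule inj_onI, clarsimp simp: pointed_def)
    fix p w u p' w' u'
    assume "fault_free \<mu> d w" "p < length w" "anchor_word \<mu> d u"
      "fault_free \<mu> d w'" "p' < length w'" "anchor_word \<mu> d u'"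
      "rotate p (w @ u) = rotate p' (w' @ u')"
    then show "p = p' \<and> w = w' \<and> u = u'"
      using *[of w p u w' p' u'] *[of w' p' u' w p u] by (cases "p \<le> p'") auto
  qed
next
  fix v assume "v \<in> (\<lambda>((p, w), u). rotate p (w @ u)) `
    (pointed (Collect (fault_free \<mu> d)) \<times> Collect (anchor_word \<mu> d))"
  then show "v \<in> cylindric \<mu> d"
    by (auto simp: pointed_def fault_free_def
        intro!: cylindric_rotate cylindric_if_anchor_word anchor_word_append)
next
  fix v assume v: "v \<in> cylindric \<mu> d"
  let ?P = "\<lambda>p. \<exists>x. anchor_word \<mu> d x \<and> v = rotate p x"
  obtain q where q: "anchor_word \<mu> d (rotate q v)"
    using cylindric_has_cut[OF assms(1) v] by blast
  have ne: "v \<noteq> []" using v by (simp add: cylindric_iff)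
  have "q mod length v < length v" using ne by simp
  \<comment> \<open>The two rotations together make a full turn, so \<open>v\<close> is itself a
    rotation of an anchor word.\<close>
  then have "rotate (length v - q mod length v) (rotate q v) = v"
    by (subst rotate_conv_mod[of q]) (simp add: rotate_rotate)
  then have "?P (length v - q mod length v)"
    using q by metis
  \<comment> \<open>Minimality of \<open>p\<close> selects the nearest cut at or before the
    origin.\<close>
  then obtain p where p: "?P p" "\<And>p'. ?P p' \<Longrightarrow> p \<le> p'"
    using LeastI[of ?P] Least_le[of ?P] by blast
  then obtain x where x: "anchor_word \<mu> d x" "v = rotate p x" by blast
  obtain w u where wu: "x = w @ u" "fault_free \<mu> d w" "anchor_word \<mu> d u"
    using fault_free_factor_exists[OF x(1) _ assms(2)] x(2) ne by auto
  have w: "anchor_word \<mu> d w" "w \<noteq> []"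
    using wu(2) by (auto simp: fault_free_def)
  have "p < length w"
  proof (rule ccontr)
    assume "\<not> ?thesis"
    \<comment> \<open>If the origin lay beyond \<open>w\<close>, moving \<open>w\<close> to the back
      would give the anchor word \<open>u @ w\<close> and a smaller offset.\<close>
    then have "v = rotate (p - length w) (rotate (length w) (w @ u))"
      using x(2) wu(1) by (simp add: rotate_rotate)
    also have "rotate (length w) (w @ u) = u @ w"
      by (rule rotate_append)
    finally have "?P (p - length w)"
      using anchor_word_append[OF wu(3) w(1)] by blast
    from p(2)[OF this] show False
      using \<open>\<not> p < length w\<close> w(2) by (cases w) auto
  qed
  moreover have "v = rotate p (w @ u)"
    using x(2) wu(1) by simp
  ultimately show "v \<in> (\<lambda>((p, w), u). rotate p (w @ u)) `
      (pointed (Collect (fault_free \<mu> d)) \<times> Collect (anchor_word \<mu> d))"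
    using wu(2,3) by (force simp: pointed_def)
qed

section \<open>The identity of series\<close>

lemma finite_anchor_words: "finite {w. anchor_word \<mu> d w \<and> length w = n}"
  by (rule finite_subset[OF _ finite_letters_words[of d n]]) (auto simp: anchor_word_def)

lemma B_series_eq_gf: "B_series \<mu> d = gf (Collect (fault_free \<mu> d)) length bigtiles"
  by (simp add: B_series_def gf_def)

lemma C_series_eq_gf: "C_series \<mu> d = 1 + gf (cylindric \<mu> d) length bigtiles"
proof -
  have "{w \<in> cylindric \<mu> d. length w = n} = (if n \<ge> 1 then cylindric_anchor_words \<mu> d n else {})"
    for n
    by (auto simp: cylindric_def cylindric_anchor_words_def Suc_le_eq)
  then show ?thesis
    unfolding C_series_def gf_def by (intro arg_cong[of _ _ "(+) 1"] fps_ext) simp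
qed

text \<open>Splitting off the first factor gives A = 1 + B A, the 1 coming from the empty
  word.\<close>

lemma gf_anchor_words:
  fixes \<mu> :: "nat list" and d :: nat
  assumes "1 \<le> ell \<mu>"
  defines "A \<equiv> gf (Collect (anchor_word \<mu> d)) length bigtiles"
  shows "A * (1 - B_series \<mu> d) = 1"
proof -
  have "gf (Collect (anchor_word \<mu> d) - {[]}) length bigtiles = B_series \<mu> d * A"
    unfolding A_def B_series_eq_gf
    by (subst gf_Times[symmetric])
      (auto simp: finite_anchor_words finite_fault_free bigtiles_append
        intro!: gf_bij_betw[OF bij_betw_first_factor[OF assms(1)]])
  moreover have "A = 1 + gf (Collect (anchor_word \<mu> d) - {[]}) length bigtiles"
  proof (rule fps_ext)
    fix n
    show "fps_nth A n = fps_nth (1 + gf (Collect (anchor_word \<mu> d) - {[]}) length bigtiles) n"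
    proof (cases "n = 0")
      case True
      have "{w \<in> Collect (anchor_word \<mu> d). length w = 0} = {[]}"
        by (auto simp: anchor_word_Nil)
      then show ?thesis
        using True by (simp add: A_def gf_nth bigtiles_def)
    next
      case False
      then show ?thesis
        by (auto simp: A_def gf_nth intro!: sum.cong)
    qed
  qed
  ultimately show ?thesis
    by (simp add: algebra_simps)
qed

text \<open>The factor containing the origin, with the origin as marked position, contributes x
  dB/dx; the anchor word after it contributes the other factor.\<close>

lemma gf_cylindric:
  assumes "int_partition \<mu>" "1 \<le> ell \<mu>"
  shows "gf (cylindric \<mu> d) length bigtiles =
    fps_X * fps_deriv (B_series \<mu> d) * gf (Collect (anchor_word \<mu> d)) length bigtiles"
proof -
  let ?S = "pointed (Collect (fault_free \<mu> d))" and ?T = "Collect (anchor_word \<mu> d)"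
  have "gf (cylindric \<mu> d) length bigtiles = gf (?S \<times> ?T)
      (\<lambda>(s, u). (length \<circ> snd) s + length u) (\<lambda>(s, u). (bigtiles \<circ> snd) s + bigtiles u)"
    by (rule gf_bij_betw[OF bij_betw_cylindric[OF assms]])
      (auto simp: bigtiles_append bigtiles_rotate)
  also have "\<dots> = gf ?S (length \<circ> snd) (bigtiles \<circ> snd) * gf ?T length bigtiles"
    by (rule gf_Times) (simp_all only: pointed_fibre, simp_all add: finite_fault_free finite_anchor_words)
  finally show ?thesis
    by (simp only: gf_pointed B_series_eq_gf)
qed

theorem theorem6p2:
  fixes \<mu> :: "nat list" and d :: nat
  assumes "int_partition \<mu>"
    and "ell \<mu> \<ge> 1"
    and "1 \<le> d" and "d \<le> \<mu> ! 0"
  shows "C_series \<mu> d =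
    1 + fps_X * fps_deriv (B_series \<mu> d) / (1 - B_series \<mu> d)"
proof -
  have "fps_X * fps_deriv (B_series \<mu> d) / (1 - B_series \<mu> d) = gf (cylindric \<mu> d) length bigtiles"
    \<comment> \<open>The quotient is cleared by multiplying with 1 - B, which then cancels against
      the series of anchor words.\<close>
    unfolding divide_one_minus_B_series_iff gf_cylindric[OF assms(1,2)]
    by (simp only: mult.assoc gf_anchor_words[OF assms(2)] mult_1_right)
  then show ?thesis
    by (simp only: C_series_eq_gf)
qed

end
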